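(* Let $n\ge 4$ and let $P_n$ be the path with $n$ vertices. If $n$ is odd, then $P_n$ is neither $\alpha$-unfrozen nor $\beta$-unfrozen. If $n$ is even, then $P_n$ is both $\alpha$-unfrozen and $\beta$-unfrozen.
   Context: Graphs are finite, undirected, simple, without loops. $P_n = (\{v_1,\ldots,v_n\},\{\{v_i,v_{i+1}\} \mid 1\le i<n\})$. $\alpha(G)$ is the size of a maximum independent set and $\beta(G)$ the size of a minimum vertex cover. A nonedge of $G$ is a pair $e=\{u,v\}$ of distinct vertices with $e\notin E(G)$; $G+e$ is $G$ with $e$ added as an edge. For a parameter $\xi$, $G$ is $\xi$-unfrozen if $\xi(G+e)=\xi(G)$ for every nonedge $e$ of $G$. *)

theory Defs
  imports Main "HOL-Library.Ramsey"
begin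

record 'a graph =
  verts :: "'a set"
  edges :: "'a set set"

definition simple_graph :: "'a graph \<Rightarrow> bool" where
  "simple_graph G \<longleftrightarrow> finite (verts G) \<and> edges G \<subseteq> [verts G]\<^bsup>2\<^esup>"

text \<open>The vertex \<open>v\<^sub>i\<close> of the path is represented by its index \<open>i\<close>.\<close>

definition path_graph :: "nat \<Rightarrow> nat graph" where
  "path_graph n = \<lparr>verts = {1..n}, edges = {{i, i + 1} | i. 1 \<le> i \<and> i < n}\<rparr>"

definition independent_set :: "'a graph \<Rightarrow> 'a set \<Rightarrow> bool" where
  "independent_set G I \<longleftrightarrow> I \<subseteq> verts G \<and> indep I (edges G)"

definition vertex_cover :: "'a graph \<Rightarrow> 'a set \<Rightarrow> bool" where
  "vertex_cover G C \<longleftrightarrow> C \<subseteq> verts G \<and> (\<forall>e \<in> edges G. e \<inter> C \<noteq> {})"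

text \<open>The values of \<open>independence_number\<close> and \<open>vertex_cover_number\<close> are meaningful for
  simple (hence finite) graphs, where the maximum and minimum are attained; see the lemmas below.\<close>

definition independence_number :: "'a graph \<Rightarrow> nat" where
  "independence_number G = Max (card ` {I. independent_set G I})"

definition vertex_cover_number :: "'a graph \<Rightarrow> nat" where
  "vertex_cover_number G = Min (card ` {C. vertex_cover G C})"

definition nonedges :: "'a graph \<Rightarrow> 'a set set" where
  "nonedges G = [verts G]\<^bsup>2\<^esup> - edges G"

definition add_edge :: "'a graph \<Rightarrow> 'a set \<Rightarrow> 'a graph" where
  "add_edge G e = G\<lparr>edges := insert e (edges G)\<rparr>"

definition unfrozen :: "('a graph \<Rightarrow> 'b) \<Rightarrow> 'a graph \<Rightarrow> bool" where
  "unfrozen \<xi> G \<longleftrightarrow> (\<forall>e \<in> nonedges G. \<xi> (add_edge G e) = \<xi> G)"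

lemma simple_graph_path_graph: "simple_graph (path_graph n)"
  by (auto simp: simple_graph_def path_graph_def)

lemma simple_graph_add_edge:
  "simple_graph G \<Longrightarrow> e \<in> nonedges G \<Longrightarrow> simple_graph (add_edge G e)"
  by (auto simp: simple_graph_def nonedges_def add_edge_def)

lemma independence_number_attained:
  assumes "simple_graph G"
  shows "\<exists>I. independent_set G I \<and> card I = independence_number G"
    and "independent_set G J \<Longrightarrow> card J \<le> independence_number G"
proof -
  have fin: "finite {I. independent_set G I}"
    using assms by (auto simp: simple_graph_def independent_set_def
        intro: finite_subset[of _ "Pow (verts G)"])
  have "independent_set G {}"
    by (simp add: independent_set_def indep_def)
  then have "independence_number G \<in> card ` {I. independent_set G I}"
    unfolding independence_number_def using fin by (intro Max_in) auto
  then show "\<exists>I. independent_set G I \<and> card I = independence_number G"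
    by (metis imageE mem_Collect_eq)
  show "card J \<le> independence_number G" if "independent_set G J"
    unfolding independence_number_def using fin that by (intro Max_ge) auto
qed

lemma vertex_cover_number_attained:
  assumes "simple_graph G"
  shows "\<exists>C. vertex_cover G C \<and> card C = vertex_cover_number G"
    and "vertex_cover G D \<Longrightarrow> vertex_cover_number G \<le> card D"
proof -
  have fin: "finite {C. vertex_cover G C}"
    using assms by (auto simp: simple_graph_def vertex_cover_def
        intro: finite_subset[of _ "Pow (verts G)"])
  have "vertex_cover G (verts G)"
    using assms by (auto simp: simple_graph_def vertex_cover_def nsets_2_eq)
  then have "vertex_cover_number G \<in> card ` {C. vertex_cover G C}"
    unfolding vertex_cover_number_def using fin by (intro Min_in) auto
  then show "\<exists>C. vertex_cover G C \<and> card C = vertex_cover_number G"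
    by (metis imageE mem_Collect_eq)
  show "vertex_cover_number G \<le> card D" if "vertex_cover G D"
    unfolding vertex_cover_number_def using fin that by (intro Min_le) auto
qed

end

theory Submission
  imports Defs
begin

text \<open>A set of vertices is independent iff its complement is a vertex cover, so
  \<open>\<alpha> + \<beta> = |V|\<close> and it suffices to treat \<open>\<alpha>\<close>. For even \<open>n\<close>, both
  the odd and the even vertices form independent sets of maximum size \<open>n div 2\<close>, and no edge can
  destroy both. For odd \<open>n\<close>, the odd vertices form an independent set of size \<open>n div 2 + 1\<close>,
  but after adding the edge \<open>{v\<^sub>1, v\<^sub>3}\<close> the vertices are covered by the triangle on
  \<open>v\<^sub>1, v\<^sub>2, v\<^sub>3\<close> and the \<open>n div 2 - 1\<close> edges
  \<open>{v\<^sub>4, v\<^sub>5}, {v\<^sub>6, v\<^sub>7}, \<dots>\<close>.\<close>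

lemma vertex_cover_complement_iff:
  assumes "simple_graph G" "C \<subseteq> verts G"
  shows "vertex_cover G (verts G - C) \<longleftrightarrow> independent_set G C"
proof
  assume cover: "vertex_cover G (verts G - C)"
  have "{x, y} \<notin> edges G" if "x \<in> C" "y \<in> C" for x y
    using cover that by (auto simp: vertex_cover_def)
  then show "independent_set G C"
    using assms(2) by (simp add: independent_set_def indep_def)
next
  assume indep: "independent_set G C"
  have "e \<inter> (verts G - C) \<noteq> {}" if e: "e \<in> edges G" for e
  proof -
    \<comment> \<open>\<open>indep\<close> only forbids edges between distinct members, so
      simplicity is used to see \<open>e\<close> as two distinct vertices of \<open>G\<close>, one
      of which must lie outside \<open>C\<close>.\<close>
    have "e \<in> [verts G]\<^bsup>2\<^esup>"
      using assms(1) e by (auto simp: simple_graph_def)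
    then obtain x y where "e = {x, y}" "x \<noteq> y" "x \<in> verts G" "y \<in> verts G"
      by (auto simp: nsets_2_eq)
    then show ?thesis
      using indep e by (auto simp: independent_set_def indep_def)
  qed
  then show "vertex_cover G (verts G - C)"
    by (auto simp: vertex_cover_def)
qed

text \<open>Each inequality complements an optimal set: a maximum independent set gives a small
  cover, a minimum cover gives a large independent set.\<close>

lemma independence_number_add_vertex_cover_number:
  assumes G: "simple_graph G"
  shows "independence_number G + vertex_cover_number G = card (verts G)"
proof (rule antisym)
  have fin: "finite (verts G)"
    using G by (simp add: simple_graph_def)
  obtain I where I: "independent_set G I" "card I = independence_number G"
    using independence_number_attained(1)[OF G] by blast
  have IV: "I \<subseteq> verts G"
    using I by (simp add: independent_set_def)
  then have "vertex_cover_number G \<le> card (verts G - I)"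
    using G I vertex_cover_complement_iff vertex_cover_number_attained(2) by blast
  then show "independence_number G + vertex_cover_number G \<le> card (verts G)"
    using I IV fin card_mono[OF fin IV] by (simp add: card_Diff_subset finite_subset)
  obtain C where C: "vertex_cover G C" "card C = vertex_cover_number G"
    using vertex_cover_number_attained(1)[OF G] by blast
  have CV: "C \<subseteq> verts G"
    using C by (simp add: vertex_cover_def)
  then have "independent_set G (verts G - C)"
    using G C vertex_cover_complement_iff[of G "verts G - C"] by (simp add: double_diff)
  then have "card (verts G - C) \<le> independence_number G"
    using independence_number_attained(2)[OF G] by blast
  then show "card (verts G) \<le> independence_number G + vertex_cover_number G"
    using C CV fin card_mono[OF fin CV] by (simp add: card_Diff_subset finite_subset)
qed

text \<open>An added edge leaves the vertex set, hence the sum of the two parameters, unchanged; so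
  either both change or neither does.\<close>

lemma unfrozen_vertex_cover_number_iff:
  assumes "simple_graph G"
  shows "unfrozen vertex_cover_number G \<longleftrightarrow> unfrozen independence_number G"
proof -
  have "vertex_cover_number (add_edge G e) = vertex_cover_number G
      \<longleftrightarrow> independence_number (add_edge G e) = independence_number G" if "e \<in> nonedges G" for e
    using independence_number_add_vertex_cover_number[OF assms]
      independence_number_add_vertex_cover_number[OF simple_graph_add_edge[OF assms that]]
    unfolding add_edge_def by simp linarith
  then show ?thesis
    by (simp add: unfrozen_def)
qed

text \<open>The range condition on edges disappears because \<open>Suc i \<in> I\<close> already
  forces \<open>i < n\<close> when \<open>I \<subseteq> {1..n}\<close>.\<close>

lemma independent_set_path_graph_iff:
  "independent_set (path_graph n) I \<longleftrightarrow> I \<subseteq> {1..n} \<and> (\<forall>i. i \<in> I \<longrightarrow> Suc i \<notin> I)"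
proof -
  have "indep I (edges (path_graph n)) \<longleftrightarrow> (\<forall>i. i \<in> I \<longrightarrow> Suc i \<notin> I)" if I: "I \<subseteq> {1..n}"
  proof
    assume indep: "indep I (edges (path_graph n))"
    show "\<forall>i. i \<in> I \<longrightarrow> Suc i \<notin> I"
    proof (intro allI impI notI)
      fix i assume i: "i \<in> I" "Suc i \<in> I"
      then have "{i, Suc i} \<in> edges (path_graph n)"
        using I by (fastforce simp: path_graph_def)
      then show False
        using i indep by (auto simp: indep_def)
    qed
  next
    assume "\<forall>i. i \<in> I \<longrightarrow> Suc i \<notin> I"
    then show "indep I (edges (path_graph n))"
      by (auto simp: indep_def path_graph_def doubleton_eq_iff)
  qed
  then show ?thesis
    by (auto simp: independent_set_def path_graph_def)
qed

lemma independent_set_add_edge_iff: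
  assumes "u \<noteq> v"
  shows "independent_set (add_edge G {u, v}) I
    \<longleftrightarrow> independent_set G I \<and> \<not> (u \<in> I \<and> v \<in> I)"
  using assms by (auto simp: independent_set_def indep_def add_edge_def doubleton_eq_iff)

lemma independent_set_path_graph_odds: "independent_set (path_graph n) {i \<in> {1..n}. odd i}"
  by (auto simp: independent_set_path_graph_iff)

lemma independent_set_path_graph_evens: "independent_set (path_graph n) {i \<in> {1..n}. even i}"
  by (auto simp: independent_set_path_graph_iff)

lemma card_odds: "card {i \<in> {1..n}. odd i} = (n + 1) div 2"
proof (induction n)
  case (Suc n)
  have "{i \<in> {1..Suc n}. odd i} =
      (if even n then insert (Suc n) {i \<in> {1..n}. odd i} else {i \<in> {1..n}. odd i})"
    by (auto simp: le_Suc_eq)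
  with Suc show ?case
    by auto
qed simp

lemma card_evens: "card {i \<in> {1..n}. even i} = n div 2"
proof (induction n)
  case (Suc n)
  have "{i \<in> {1..Suc n}. even i} =
      (if odd n then insert (Suc n) {i \<in> {1..n}. even i} else {i \<in> {1..n}. even i})"
    by (auto simp: le_Suc_eq)
  with Suc show ?case
    by auto
qed simp

text \<open>The edges {1,2}, {3,4}, ..., with vertex \<open>n\<close> left over when
  \<open>n\<close> is odd, partition the path. The map \<open>(i + 1) div 2\<close> numbers these
  classes, and \<open>I\<close> meets each at most once.\<close>

lemma card_independent_set_path_graph_le:
  assumes "independent_set (path_graph n) I"
  shows "card I \<le> (n + 1) div 2"
proof -
  have I: "I \<subseteq> {1..n}" "\<And>i. i \<in> I \<Longrightarrow> Suc i \<notin> I"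
    using assms by (auto simp: independent_set_path_graph_iff)
  have "inj_on (\<lambda>i. (i + 1) div 2) I"
  proof (rule inj_onI)
    fix i j assume ij: "i \<in> I" "j \<in> I" "(i + 1) div 2 = (j + 1) div 2"
    then have "i = j \<or> i = Suc j \<or> j = Suc i"
      by presburger
    then show "i = j"
      using ij I(2) by blast
  qed
  moreover have "(\<lambda>i. (i + 1) div 2) ` I \<subseteq> {1..(n + 1) div 2}"
  proof
    fix k assume "k \<in> (\<lambda>i. (i + 1) div 2) ` I"
    then obtain i where "k = (i + 1) div 2" "1 \<le> i" "i \<le> n"
      using I(1) by fastforce
    then show "k \<in> {1..(n + 1) div 2}"
      by (auto intro: div_le_mono)
  qed
  ultimately have "card I \<le> card {1..(n + 1) div 2}"
    by (rule card_inj_on_le) simp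
  then show ?thesis
    by simp
qed

text \<open>The second hypothesis expresses independence with respect to the chord {1,3}, so that 1,
  2, 3 act as a triangle.\<close>

lemma card_independent_set_path_graph_chord_le:
  assumes "independent_set (path_graph n) I" "\<not> (1 \<in> I \<and> 3 \<in> I)" "n \<ge> 2"
  shows "card I \<le> n div 2"
proof -
  have I: "I \<subseteq> {1..n}" "\<And>i. i \<in> I \<Longrightarrow> Suc i \<notin> I"
    using assms by (auto simp: independent_set_path_graph_iff)
  \<comment> \<open>\<open>?f\<close> numbers the classes {1,2,3}, {4,5}, {6,7}, ...; vertex 1 is an
    exception since \<open>1 div 2 = 0\<close> would give it a class of its own.\<close>
  let ?f = "\<lambda>i. if i = 1 then 1 else i div 2"
  have "inj_on ?f I"
  proof (rule inj_onI)
    fix i j assume ij: "i \<in> I" "j \<in> I" "?f i = ?f j"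
    have pos: "1 \<le> i" "1 \<le> j"
      using ij I(1) by auto
    have step: "k = l \<or> k = Suc l \<or> l = Suc k" if "k div 2 = l div 2" for k l :: nat
      using that by presburger
    have one: "k = 2 \<or> k = 3" if "k div 2 = 1" for k :: nat
      using that by presburger
    \<comment> \<open>Distinct vertices of one class are consecutive, except for the ends 1 and 3 of
      the chord.\<close>
    have "i = j \<or> i = Suc j \<or> j = Suc i \<or> (i = 1 \<and> j = 3) \<or> (i = 3 \<and> j = 1)"
      using pos ij(3) step[of i j] one[of i] one[of j] by (cases "i = 1"; cases "j = 1") auto
    then show "i = j"
      using ij I(2) assms(2) by blast
  qed
  moreover have "?f ` I \<subseteq> {1..n div 2}"
  proof
    fix k assume "k \<in> ?f ` I"
    then obtain i where "k = ?f i" "1 \<le> i" "i \<le> n"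
      using I(1) by fastforce
    \<comment> \<open>Here \<open>n \<ge> 2\<close> keeps the value 1 taken at vertex 1 within
      range.\<close>
    then show "k \<in> {1..n div 2}"
      using assms(3) by (auto simp: div_le_mono Suc_le_eq div_greater_zero_iff)
  qed
  ultimately have "card I \<le> card {1..n div 2}"
    by (rule card_inj_on_le) simp
  then show ?thesis
    by simp
qed

lemma independence_number_path_graph: "independence_number (path_graph n) = (n + 1) div 2"
  using independence_number_attained[OF simple_graph_path_graph, of n]
    card_independent_set_path_graph_le independent_set_path_graph_odds card_odds
  by (metis antisym)

lemma unfrozen_independence_number_path_graph_even:
  assumes "even n"
  shows "unfrozen independence_number (path_graph n)"
  unfolding unfrozen_def
proof
  fix e assume e: "e \<in> nonedges (path_graph n)"
  have simple: "simple_graph (add_edge (path_graph n) e)"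
    using simple_graph_add_edge[OF simple_graph_path_graph e] .
  obtain u v where uv: "e = {u, v}" "u \<noteq> v"
    using e by (auto simp: nonedges_def nsets_2_eq)
  have "\<exists>I. independent_set (add_edge (path_graph n) e) I \<and> card I = (n + 1) div 2"
  \<comment> \<open>Missing one endpoint of the new edge suffices, so the parity class not
    containing \<open>u\<close> is chosen.\<close>
  proof (cases "even u")
    case True
    then show ?thesis
      using independent_set_path_graph_odds[of n] card_odds[of n]
      by (intro exI[of _ "{i \<in> {1..n}. odd i}"]) (simp add: uv independent_set_add_edge_iff)
  next
    case False
    \<comment> \<open>Evenness of \<open>n\<close> gives \<open>n div 2 = (n + 1) div 2\<close>, so
      the even vertices are as numerous as the odd ones.\<close>
    then show ?thesis
      using independent_set_path_graph_evens[of n] card_evens[of n] assms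
      by (intro exI[of _ "{i \<in> {1..n}. even i}"]) (simp add: uv independent_set_add_edge_iff)
  qed
  then have "(n + 1) div 2 \<le> independence_number (add_edge (path_graph n) e)"
    using independence_number_attained(2)[OF simple] by metis
  \<comment> \<open>A set independent after adding an edge was independent before, so the bound for
    the path persists.\<close>
  moreover have "independence_number (add_edge (path_graph n) e) \<le> (n + 1) div 2"
    using independence_number_attained(1)[OF simple] card_independent_set_path_graph_le
    by (metis independent_set_add_edge_iff uv)
  ultimately show "independence_number (add_edge (path_graph n) e) =
      independence_number (path_graph n)"
    by (simp add: independence_number_path_graph)
qed

lemma not_unfrozen_independence_number_path_graph_odd:
  assumes "odd n" "n \<ge> 3"
  shows "\<not> unfrozen independence_number (path_graph n)"
proof
  assume unfrozen: "unfrozen independence_number (path_graph n)"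
  have e: "{1, 3} \<in> nonedges (path_graph n)"
    using assms by (simp add: nonedges_def path_graph_def doubleton_eq_iff)
  obtain I where I: "independent_set (add_edge (path_graph n) {1, 3}) I"
      "card I = independence_number (add_edge (path_graph n) {1, 3})"
    using independence_number_attained(1)[OF simple_graph_add_edge[OF simple_graph_path_graph e]]
    by blast
  then have "card I \<le> n div 2"
    using card_independent_set_path_graph_chord_le[of n I] assms
    by (simp add: independent_set_add_edge_iff)
  moreover have "card I = (n + 1) div 2"
    using I(2) e unfrozen by (simp add: unfrozen_def independence_number_path_graph)
  \<comment> \<open>For odd \<open>n\<close> the two values differ by one.\<close>
  ultimately show False
    using assms(1) by presburger
qed

theorem proposition4:
  fixes n :: nat
  assumes "n \<ge> 4"
  shows "(odd n \<longrightarrow> \<not> unfrozen independence_number (path_graph n)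
                  \<and> \<not> unfrozen vertex_cover_number (path_graph n))
       \<and> (even n \<longrightarrow> unfrozen independence_number (path_graph n)
                   \<and> unfrozen vertex_cover_number (path_graph n))"
  using assms unfrozen_independence_number_path_graph_even[of n]
    not_unfrozen_independence_number_path_graph_odd[of n]
    unfrozen_vertex_cover_number_iff[OF simple_graph_path_graph, of n]
  by auto

end
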